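(* The algorithm PA-II is stable, i.e., for each $n\in\{0,\dots,N-1\}$ and each $k\ge 0$ its iterates satisfy $$\|U_{n+1}^{k+1}\|\le \|u^{0}\|+(n+1)\Big(\max_{0\le j\le n}\|U_j^{k}\|\Big).$$
   Context: Let $h>0$, let $N_x\ge 3$ be an integer, and let $D_h=\frac1{h^2}\,\mathrm{tridiag}(1,-2,1)\in\mathbb{R}^{(N_x-2)\times(N_x-2)}$ be the discrete Dirichlet Laplacian (diagonal entries $-2/h^2$, sub- and superdiagonal entries $1/h^2$, all others $0$). Let $\epsilon>0$, $T>0$, integers $N\ge1$ and $J\ge2$, $\Delta T=T/N$, $\Delta t=\Delta T/J$, $T_n=n\Delta T$. $\|\cdot\|$ is the Euclidean norm on $\mathbb{R}^{N_x-2}$ and the induced matrix norm. For $i\in\{1,2\}$ set $$P_i=(I-i\Delta T D_h+\epsilon^2\Delta T D_h^2)^{-1}(I-i\Delta T D_h),\qquad P_{J_i}=\Big[\big(I-\tfrac{i\Delta T}{J}D_h+\epsilon^2\tfrac{\Delta T}{J}D_h^2\big)^{-1}\big(I-\tfrac{i\Delta T}{J}D_h\big)\Big]^J .$$ Parareal iteration: given a fine propagator $\mathcal F$ and a coarse propagator $\mathcal G$ (maps $\mathbb{R}^{N_x-2}\to\mathbb{R}^{N_x-2}$ advancing the solution from $T_n$ to $T_{n+1}$) and $u^0\in\mathbb{R}^{N_x-2}$, the initial guess is $U_0^0=u^0$, $U_{n+1}^0=\mathcal G(U_n^0)$, and for $k=0,1,2,\dots$ $$U_0^{k+1}=u^0,\qquad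 U_{n+1}^{k+1}=\mathcal G(U_n^{k+1})+\mathcal F(U_n^k)-\mathcal G(U_n^k),\quad 0\le n\le N-1.$$ PA-II (in the form analyzed): the Parareal iteration with $\mathcal F(U)=P_{J_2}U$ and $\mathcal G(U)=P_2U$. These are the propagators of the linear convex-splitting scheme $\frac{W^{n+1}-W^n}{\Delta t}=D_h\,\mathrm{diag}(W^n)^2W^{n}-3D_hW^n-\epsilon^2D_h^2W^{n+1}+2D_hW^{n+1}$ for the Cahn-Hilliard equation, with $\mathrm{diag}(W^n)^2$ replaced by $I$; $\mathcal F$ takes $J$ steps of size $\Delta t$ and $\mathcal G$ one step of size $\Delta T$. *)

theory Defs
  imports
    "HOL-Analysis.L2_Norm"
    "Jordan_Normal_Form.Gauss_Jordan_Elimination"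
begin

definition euclid_norm :: "real vec \<Rightarrow> real" where
  "euclid_norm v = L2_set (\<lambda>i. v $ i) {0..<dim_vec v}"

definition dirichlet_laplacian :: "nat \<Rightarrow> real \<Rightarrow> real mat" where
  "dirichlet_laplacian m h = (1 / h\<^sup>2) \<cdot>\<^sub>m
     mat m m (\<lambda>(i, j). if i = j then -2 else if i = Suc j \<or> j = Suc i then 1 else 0)"

text \<open>The inverse of a nonsingular matrix; unspecified when the matrix is singular.\<close>

definition matrix_inverse :: "real mat \<Rightarrow> real mat" where
  "matrix_inverse A = the (mat_inverse A)"

text \<open>For \<open>i = 2\<close>, the case PA-II uses, this is one step of size \<open>\<tau>\<close> of
  \[(W^{n+1} - W^n) / \tau = D W^n - 3 D W^n - \epsilon^2 D^2 W^{n+1} + 2 D W^{n+1}\]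
  solved for \<open>W\<close> at the new time level: the linear convex-splitting scheme with
  \<open>diag(W)\<^sup>2\<close> replaced by the identity.\<close>

definition step_mat :: "nat \<Rightarrow> real \<Rightarrow> real \<Rightarrow> nat \<Rightarrow> real \<Rightarrow> real mat" where
  "step_mat m h \<epsilon> i \<tau> = (let D = dirichlet_laplacian m h in
     matrix_inverse (1\<^sub>m m - (real i * \<tau>) \<cdot>\<^sub>m D + (\<epsilon>\<^sup>2 * \<tau>) \<cdot>\<^sub>m (D * D))
       * (1\<^sub>m m - (real i * \<tau>) \<cdot>\<^sub>m D))"

definition coarse_mat :: "nat \<Rightarrow> real \<Rightarrow> real \<Rightarrow> nat \<Rightarrow> real \<Rightarrow> real mat" where
  "coarse_mat m h \<epsilon> i \<Delta>T = step_mat m h \<epsilon> i \<Delta>T"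

definition fine_mat :: "nat \<Rightarrow> real \<Rightarrow> real \<Rightarrow> nat \<Rightarrow> nat \<Rightarrow> real \<Rightarrow> real mat" where
  "fine_mat m h \<epsilon> J i \<Delta>T = step_mat m h \<epsilon> i (\<Delta>T / real J) ^\<^sub>m J"

text \<open>\<open>parareal F G u\<^sub>0 k n\<close> is the iterate \<open>U\<^sub>n\<^sup>k\<close>. The recursion makes sense for every
  \<open>n\<close>; a time grid with \<open>N\<close> subintervals uses the iterates with \<open>n \<le> N\<close>, which do not
  depend on the later ones.\<close>

fun parareal ::
  "(real vec \<Rightarrow> real vec) \<Rightarrow> (real vec \<Rightarrow> real vec) \<Rightarrow> real vec \<Rightarrow> nat \<Rightarrow> nat \<Rightarrow> real vec"
where
  "parareal F G u\<^sub>0 k 0 = u\<^sub>0"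
| "parareal F G u\<^sub>0 0 (Suc n) = G (parareal F G u\<^sub>0 0 n)"
| "parareal F G u\<^sub>0 (Suc k) (Suc n) =
     G (parareal F G u\<^sub>0 (Suc k) n) + F (parareal F G u\<^sub>0 k n) - G (parareal F G u\<^sub>0 k n)"

definition PA_II ::
  "nat \<Rightarrow> real \<Rightarrow> real \<Rightarrow> nat \<Rightarrow> real \<Rightarrow> real vec \<Rightarrow> nat \<Rightarrow> nat \<Rightarrow> real vec"
where
  "PA_II m h \<epsilon> J \<Delta>T = parareal
     (\<lambda>v. fine_mat m h \<epsilon> J 2 \<Delta>T *\<^sub>v v)
     (\<lambda>v. coarse_mat m h \<epsilon> 2 \<Delta>T *\<^sub>v v)"

end

theory Submission
  imports Defs "Jordan_Normal_Form.Determinant"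
begin

text \<open>
  Write \<open>G\<close> and \<open>F\<close> for the coarse and the fine propagator. The parareal
  recursion reads
    \[U_{n+1}^{k+1} = G U_n^{k+1} + (F - G) U_n^k,\]
  so the bound follows by induction on \<open>n\<close> as soon as \<open>G\<close> and \<open>F - G\<close> are contractions
  (\<open>parareal_norm_le_sum\<close>).

  Spectrally, \<open>G\<close> and \<open>F\<close> are functions of the symmetric matrix \<open>D\<close> with eigenvalues in
  \<open>[0, 1]\<close>, whence the claim. The proof replaces eigenvalues by the inequality
  \<open>|P v|\<^sup>2 \<le> \<langle>P v, v\<rangle>\<close>, called firm nonexpansiveness. It says that \<open>P v\<close> lies in the
  ball with diameter from \<open>0\<close> to \<open>v\<close>. Hence \<open>|P v| \<le> |v|\<close>, and two points of that ball have
  distance at most \<open>|v|\<close>, which bounds \<open>F - G\<close> without any diagonalization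
  (\<open>firmly_nonexpansive_diff\<close>).

  One implicit step has the form \<open>P v = A w\<close> where \<open>v = A w + c D\<^sup>2 w\<close> and \<open>A = I - a D\<close>
  with \<open>a, c \<ge> 0\<close>. Thus \<open>\<langle>P v, v\<rangle> = |A w|\<^sup>2 + c \<langle>A w, D\<^sup>2 w\<rangle>\<close>, and
  \<open>\<langle>A w, D\<^sup>2 w\<rangle> = |D w|\<^sup>2 - a \<langle>D w, D (D w)\<rangle> \<ge> 0\<close> because \<open>D\<close> is symmetric and negative
  semidefinite. So a step of any size is firmly nonexpansive, and it is self-adjoint since
  everything commutes with \<open>D\<close>. A power \<open>P\<^sup>J\<close> inherits both properties by moving half of
  the factors to the other side of the inner product.
\<close>

section \<open>The Euclidean norm and the inner product\<close>

lemma euclid_norm_sqrt: "euclid_norm v = sqrt (v \<bullet> v)"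
  by (simp add: euclid_norm_def L2_set_def scalar_prod_def power2_eq_square)

lemma euclid_norm_triangle:
  assumes "x \<in> carrier_vec n" "y \<in> carrier_vec n"
  shows "euclid_norm (x + y) \<le> euclid_norm x + euclid_norm y"
  using assms L2_set_triangle_ineq[of "\<lambda>i. x $ i" "\<lambda>i. y $ i" "{0..<n}"]
  by (simp add: euclid_norm_def L2_set_def)

lemma scalar_prod_self_nonneg: "0 \<le> (v :: real vec) \<bullet> v"
  by (simp add: scalar_prod_def sum_nonneg)

lemma scalar_prod_self_eq_0:
  assumes "(v :: real vec) \<in> carrier_vec n" "v \<bullet> v \<le> 0"
  shows "v = 0\<^sub>v n"
proof -
  have "v \<bullet> v = 0" using assms(2) scalar_prod_self_nonneg[of v] by linarith
  then have "\<forall>i<n. v $ i = 0"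
    using assms(1) by (auto simp: scalar_prod_def sum_nonneg_eq_0_iff)
  then show ?thesis using assms(1) by auto
qed

lemma smult_mat_mult_vec:
  fixes A :: "real mat"
  assumes "A \<in> carrier_mat n m" "v \<in> carrier_vec m"
  shows "(c \<cdot>\<^sub>m A) *\<^sub>v v = c \<cdot>\<^sub>v (A *\<^sub>v v)"
  using assms by (intro eq_vecI) auto

section \<open>Self-adjoint and firmly nonexpansive matrices\<close>

definition self_adjoint :: "nat \<Rightarrow> real mat \<Rightarrow> bool" where
  "self_adjoint n P \<longleftrightarrow> P \<in> carrier_mat n n \<and>
     (\<forall>x\<in>carrier_vec n. \<forall>y\<in>carrier_vec n. (P *\<^sub>v x) \<bullet> y = x \<bullet> (P *\<^sub>v y))"

definition firmly_nonexpansive :: "nat \<Rightarrow> real mat \<Rightarrow> bool" where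
  "firmly_nonexpansive n P \<longleftrightarrow> P \<in> carrier_mat n n \<and>
     (\<forall>v\<in>carrier_vec n. (P *\<^sub>v v) \<bullet> (P *\<^sub>v v) \<le> (P *\<^sub>v v) \<bullet> v)"

lemma self_adjointD:
  assumes "self_adjoint n P" "x \<in> carrier_vec n" "y \<in> carrier_vec n"
  shows "(P *\<^sub>v x) \<bullet> y = x \<bullet> (P *\<^sub>v y)"
  using assms by (auto simp: self_adjoint_def)

lemma firmly_nonexpansiveD:
  assumes "firmly_nonexpansive n P" "v \<in> carrier_vec n"
  shows "(P *\<^sub>v v) \<bullet> (P *\<^sub>v v) \<le> (P *\<^sub>v v) \<bullet> v"
  using assms by (auto simp: firmly_nonexpansive_def)

text \<open>Expanding \<open>|v - P v|\<^sup>2 \<ge> 0\<close> gives \<open>2 \<langle>P v, v\<rangle> \<le> |v|\<^sup>2 + |P v|\<^sup>2\<close>, and the left-hand side is at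
  least \<open>2 |P v|\<^sup>2\<close>.\<close>

lemma firmly_nonexpansive_contraction:
  assumes P: "firmly_nonexpansive n P" and v: "v \<in> carrier_vec n"
  shows "(P *\<^sub>v v) \<bullet> (P *\<^sub>v v) \<le> v \<bullet> v"
proof -
  define p where "p = P *\<^sub>v v"
  have p: "p \<in> carrier_vec n"
    using P v unfolding p_def firmly_nonexpansive_def by auto
  have "0 \<le> (v - p) \<bullet> (v - p)" by (rule scalar_prod_self_nonneg)
  also have "\<dots> = v \<bullet> v - 2 * (p \<bullet> v) + p \<bullet> p"
    using p v by (simp add: minus_scalar_prod_distrib[of _ n] scalar_prod_minus_distrib[of _ n]
        comm_scalar_prod[of v n p])
  finally show ?thesis
    using firmly_nonexpansiveD[OF P v] unfolding p_def by linarith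
qed

text \<open>The images \<open>p\<close> and \<open>q\<close> of \<open>v\<close> lie in the ball with centre \<open>v/2\<close> and radius \<open>|v|/2\<close>, so
  their distance is at most its diameter. Algebraically this is the parallelogram law, whose other
  term is \<open>|p + q - v|\<^sup>2\<close>.\<close>

lemma firmly_nonexpansive_diff:
  assumes P: "firmly_nonexpansive n P" and Q: "firmly_nonexpansive n Q"
    and v: "v \<in> carrier_vec n"
  shows "(P *\<^sub>v v - Q *\<^sub>v v) \<bullet> (P *\<^sub>v v - Q *\<^sub>v v) \<le> v \<bullet> v"
proof -
  define p q where "p = P *\<^sub>v v" and "q = Q *\<^sub>v v"
  have p: "p \<in> carrier_vec n" and q: "q \<in> carrier_vec n"
    using P Q v unfolding p_def q_def firmly_nonexpansive_def by auto
  have pv: "p \<bullet> p \<le> p \<bullet> v" and qv: "q \<bullet> q \<le> q \<bullet> v"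
    using firmly_nonexpansiveD[OF P v] firmly_nonexpansiveD[OF Q v]
    by (auto simp: p_def q_def)
  note expand = minus_scalar_prod_distrib[of _ n] scalar_prod_minus_distrib[of _ n]
    add_scalar_prod_distrib[of _ n] scalar_prod_add_distrib[of _ n]
    comm_scalar_prod[of v n p] comm_scalar_prod[of v n q] comm_scalar_prod[of q n p]
  have "0 \<le> (p + q - v) \<bullet> (p + q - v)" by (rule scalar_prod_self_nonneg)
  also have "\<dots> = p \<bullet> p + q \<bullet> q + v \<bullet> v + 2 * (p \<bullet> q) - 2 * (p \<bullet> v) - 2 * (q \<bullet> v)"
    using p q v by (simp add: expand)
  finally have "0 \<le> p \<bullet> p + q \<bullet> q + v \<bullet> v + 2 * (p \<bullet> q) - 2 * (p \<bullet> v) - 2 * (q \<bullet> v)" .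
  moreover have "(p - q) \<bullet> (p - q) = p \<bullet> p + q \<bullet> q - 2 * (p \<bullet> q)"
    using p q by (simp add: expand)
  ultimately show ?thesis using pv qv unfolding p_def q_def by linarith
qed

section \<open>Powers\<close>

lemma pow_mat_add_mult_vec:
  fixes P :: "real mat"
  assumes P: "P \<in> carrier_mat n n" and v: "v \<in> carrier_vec n"
  shows "(P ^\<^sub>m (j + k)) *\<^sub>v v = (P ^\<^sub>m j) *\<^sub>v ((P ^\<^sub>m k) *\<^sub>v v)"
  using v
proof (induction k arbitrary: v)
  case 0
  then show ?case using P by simp
next
  case (Suc k)
  have Pk: "P ^\<^sub>m i \<in> carrier_mat n n" for i using P by simp
  have Pv: "P *\<^sub>v v \<in> carrier_vec n" using P Suc.prems by simp
  show ?case
    using Suc.IH[OF Pv] Suc.prems P assoc_mult_mat_vec[OF Pk P Suc.prems]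
    by simp
qed

lemma self_adjoint_pow:
  assumes P: "self_adjoint n P"
  shows "self_adjoint n (P ^\<^sub>m k)"
proof (induction k)
  case 0
  show ?case using P by (auto simp: self_adjoint_def)
next
  case (Suc k)
  have PC: "P \<in> carrier_mat n n" using P by (simp add: self_adjoint_def)
  have Pk: "P ^\<^sub>m k \<in> carrier_mat n n" using PC by simp
  show ?case unfolding self_adjoint_def
  proof (intro conjI ballI)
    show "P ^\<^sub>m Suc k \<in> carrier_mat n n" using PC by (metis pow_carrier_mat)
    fix x y :: "real vec" assume x: "x \<in> carrier_vec n" and y: "y \<in> carrier_vec n"
    have "(P ^\<^sub>m Suc k *\<^sub>v x) \<bullet> y = (P ^\<^sub>m k *\<^sub>v (P *\<^sub>v x)) \<bullet> y"
      using assoc_mult_mat_vec[OF Pk PC x] by simp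
    also have "\<dots> = (P *\<^sub>v x) \<bullet> (P ^\<^sub>m k *\<^sub>v y)"
      using self_adjointD[OF Suc] PC x y by simp
    also have "\<dots> = x \<bullet> (P *\<^sub>v (P ^\<^sub>m k *\<^sub>v y))"
      using self_adjointD[OF P x] Pk y by simp
    also have "P *\<^sub>v (P ^\<^sub>m k *\<^sub>v y) = P ^\<^sub>m Suc k *\<^sub>v y"
      using pow_mat_add_mult_vec[OF PC y, of 1 k] PC by simp
    finally show "(P ^\<^sub>m Suc k *\<^sub>v x) \<bullet> y = x \<bullet> (P ^\<^sub>m Suc k *\<^sub>v y)" .
  qed
qed

lemma firmly_nonexpansive_pow_contraction:
  assumes P: "firmly_nonexpansive n P" and v: "v \<in> carrier_vec n"
  shows "(P ^\<^sub>m k *\<^sub>v v) \<bullet> (P ^\<^sub>m k *\<^sub>v v) \<le> v \<bullet> v"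
  using v
proof (induction k arbitrary: v)
  case 0
  then show ?case using P by (auto simp: firmly_nonexpansive_def)
next
  case (Suc k)
  have PC: "P \<in> carrier_mat n n" using P by (simp add: firmly_nonexpansive_def)
  have Pk: "P ^\<^sub>m k \<in> carrier_mat n n" using PC by simp
  have Pv: "P *\<^sub>v v \<in> carrier_vec n" using PC Suc.prems by simp
  show ?case
    using Suc.IH[OF Pv] firmly_nonexpansive_contraction[OF P Suc.prems]
      assoc_mult_mat_vec[OF Pk PC Suc.prems] by simp
qed

text \<open>Self-adjointness is essential here: the composition of two firmly nonexpansive maps need not
  be firmly nonexpansive, and a plane rotation by \<open>60\<close> degrees scaled by \<open>1/2\<close> has a square
  without the property. With \<open>w = P\<^sup>j v\<close> one has \<open>\<langle>P\<^sup>2\<^sup>j v, v\<rangle> = |w|\<^sup>2\<close> and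
  \<open>\<langle>P\<^sup>2\<^sup>j\<^sup>+\<^sup>1 v, v\<rangle> = \<langle>P w, w\<rangle> \<ge> |P w|\<^sup>2\<close>; the remaining \<open>j\<close> factors only shrink the vector.\<close>

lemma firmly_nonexpansive_pow:
  assumes S: "self_adjoint n P" and P: "firmly_nonexpansive n P"
  shows "firmly_nonexpansive n (P ^\<^sub>m k)"
  unfolding firmly_nonexpansive_def
proof (intro conjI ballI)
  have PC: "P \<in> carrier_mat n n" using P by (simp add: firmly_nonexpansive_def)
  then show "P ^\<^sub>m k \<in> carrier_mat n n" by simp
  fix v :: "real vec" assume v: "v \<in> carrier_vec n"
  define j where "j = k div 2"
  define w where "w = P ^\<^sub>m j *\<^sub>v v"
  have w: "w \<in> carrier_vec n"
    unfolding w_def using pow_carrier_mat[OF PC] v by (rule mult_mat_vec_carrier)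
  have Pw: "P *\<^sub>v w \<in> carrier_vec n" using PC w by simp
  have half: "(P ^\<^sub>m j *\<^sub>v x) \<bullet> v = x \<bullet> w" if "x \<in> carrier_vec n" for x
    unfolding w_def by (rule self_adjointD[OF self_adjoint_pow[OF S] that v])
  show "(P ^\<^sub>m k *\<^sub>v v) \<bullet> (P ^\<^sub>m k *\<^sub>v v) \<le> (P ^\<^sub>m k *\<^sub>v v) \<bullet> v"
  proof (cases "even k")
    case True
    then have "k = j + j" by (auto simp: j_def)
    then have "P ^\<^sub>m k *\<^sub>v v = P ^\<^sub>m j *\<^sub>v w"
      using pow_mat_add_mult_vec[OF PC v, of j j] by (simp add: w_def)
    then show ?thesis
      using half[OF w] firmly_nonexpansive_pow_contraction[OF P w, of j] by simp
  next
    case False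
    then have "k = j + (1 + j)" by (auto simp: j_def elim: oddE)
    then have "P ^\<^sub>m k *\<^sub>v v = P ^\<^sub>m j *\<^sub>v (P *\<^sub>v w)"
      using pow_mat_add_mult_vec[OF PC v, of j "1 + j"] pow_mat_add_mult_vec[OF PC v, of 1 j] PC
      by (simp add: w_def)
    then show ?thesis
      using half[OF Pw] firmly_nonexpansive_pow_contraction[OF P Pw, of j]
        firmly_nonexpansiveD[OF P w] by simp
  qed
qed

section \<open>The implicit step of a negative semidefinite matrix\<close>

lemma matrix_inverse_of_trivial_kernel:
  assumes M: "M \<in> carrier_mat n n"
    and ker: "\<And>v. v \<in> carrier_vec n \<Longrightarrow> M *\<^sub>v v = 0\<^sub>v n \<Longrightarrow> v = 0\<^sub>v n"
  shows "matrix_inverse M \<in> carrier_mat n n"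
    and "M * matrix_inverse M = 1\<^sub>m n"
    and "matrix_inverse M * M = 1\<^sub>m n"
proof -
  have "det M \<noteq> 0" using det_0_iff_vec_prod_zero[OF M] ker by blast
  then have "mat_inverse M \<noteq> None"
    using det_non_zero_imp_unit[OF M, of "()"] mat_inverse(1)[OF M, of "()"] by blast
  then have "mat_inverse M = Some (matrix_inverse M)" by (auto simp: matrix_inverse_def)
  from mat_inverse(2)[OF M this]
  show "matrix_inverse M \<in> carrier_mat n n" "M * matrix_inverse M = 1\<^sub>m n"
    "matrix_inverse M * M = 1\<^sub>m n" by auto
qed

locale implicit_step =
  fixes n :: nat and D :: "real mat" and a c :: real
  assumes sa: "self_adjoint n D"
    and neg: "\<And>v. v \<in> carrier_vec n \<Longrightarrow> v \<bullet> (D *\<^sub>v v) \<le> 0"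
    and a: "0 \<le> a" and c: "0 \<le> c"
begin

definition "A = 1\<^sub>m n - a \<cdot>\<^sub>m D"
definition "M = 1\<^sub>m n - a \<cdot>\<^sub>m D + c \<cdot>\<^sub>m (D * D)"

lemma D_carrier: "D \<in> carrier_mat n n"
  using sa by (simp add: self_adjoint_def)

lemma A_carrier: "A \<in> carrier_mat n n" and M_carrier: "M \<in> carrier_mat n n"
  using D_carrier by (auto simp: A_def M_def)

lemma D_vec: "v \<in> carrier_vec n \<Longrightarrow> D *\<^sub>v v \<in> carrier_vec n"
  using D_carrier by simp

lemma A_vec: "v \<in> carrier_vec n \<Longrightarrow> A *\<^sub>v v \<in> carrier_vec n"
  using A_carrier by simp

lemma A_apply:
  assumes "v \<in> carrier_vec n"
  shows "A *\<^sub>v v = v - a \<cdot>\<^sub>v (D *\<^sub>v v)"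
  using assms D_carrier minus_mult_distrib_mat_vec[of "1\<^sub>m n" n n "a \<cdot>\<^sub>m D" v]
  by (simp add: A_def smult_mat_mult_vec[of _ n n])

lemma M_apply:
  assumes v: "v \<in> carrier_vec n"
  shows "M *\<^sub>v v = A *\<^sub>v v + c \<cdot>\<^sub>v (D *\<^sub>v (D *\<^sub>v v))"
proof -
  have DD: "D * D \<in> carrier_mat n n" using D_carrier by simp
  have "M *\<^sub>v v = (A + c \<cdot>\<^sub>m (D * D)) *\<^sub>v v" by (simp add: M_def A_def)
  also have "\<dots> = A *\<^sub>v v + (c \<cdot>\<^sub>m (D * D)) *\<^sub>v v"
    using A_carrier DD v by (intro add_mult_distrib_mat_vec) auto
  also have "(c \<cdot>\<^sub>m (D * D)) *\<^sub>v v = c \<cdot>\<^sub>v (D *\<^sub>v (D *\<^sub>v v))"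
    using smult_mat_mult_vec[OF DD v] assoc_mult_mat_vec[OF D_carrier D_carrier v] by simp
  finally show ?thesis .
qed

lemma D_A_commute:
  assumes v: "v \<in> carrier_vec n"
  shows "D *\<^sub>v (A *\<^sub>v v) = A *\<^sub>v (D *\<^sub>v v)"
  using v D_carrier D_vec[OF v]
  by (simp add: A_apply mult_minus_distrib_mat_vec[of D n n] mult_mat_vec[of D n n])

lemma A_self_adjoint: "self_adjoint n A"
  unfolding self_adjoint_def
proof (intro conjI ballI)
  show "A \<in> carrier_mat n n" by (rule A_carrier)
  fix x y :: "real vec" assume x: "x \<in> carrier_vec n" and y: "y \<in> carrier_vec n"
  show "(A *\<^sub>v x) \<bullet> y = x \<bullet> (A *\<^sub>v y)"
    using x y D_vec[OF x] D_vec[OF y] self_adjointD[OF sa x y]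
    by (simp add: A_apply minus_scalar_prod_distrib[of _ n] scalar_prod_minus_distrib[of _ n])
qed

lemma M_A_commute:
  assumes v: "v \<in> carrier_vec n"
  shows "M *\<^sub>v (A *\<^sub>v v) = A *\<^sub>v (M *\<^sub>v v)"
  using v A_carrier A_vec[OF v] D_vec[OF v] D_vec[OF D_vec[OF v]]
  by (simp add: M_apply D_A_commute mult_add_distrib_mat_vec[of A n n] mult_mat_vec[of A n n])

lemma cross_term_nonneg:
  assumes w: "w \<in> carrier_vec n"
  shows "0 \<le> (A *\<^sub>v w) \<bullet> (D *\<^sub>v (D *\<^sub>v w))"
proof -
  define d where "d = D *\<^sub>v w"
  have d: "d \<in> carrier_vec n" unfolding d_def by (rule D_vec[OF w])
  have "(A *\<^sub>v w) \<bullet> (D *\<^sub>v d) = w \<bullet> (D *\<^sub>v d) - a * (d \<bullet> (D *\<^sub>v d))"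
    using w d D_vec[OF d] by (simp add: A_apply d_def minus_scalar_prod_distrib[of _ n])
  also have "w \<bullet> (D *\<^sub>v d) = d \<bullet> d"
    using self_adjointD[OF sa w d] by (simp add: d_def)
  finally show ?thesis
    using scalar_prod_self_nonneg[of d] mult_nonneg_nonpos[OF a neg[OF d]]
    by (simp add: d_def)
qed

lemma A_M_lower_bound:
  assumes w: "w \<in> carrier_vec n"
  shows "(A *\<^sub>v w) \<bullet> (A *\<^sub>v w) \<le> (A *\<^sub>v w) \<bullet> (M *\<^sub>v w)"
proof -
  have "(A *\<^sub>v w) \<bullet> (M *\<^sub>v w)
      = (A *\<^sub>v w) \<bullet> (A *\<^sub>v w) + c * ((A *\<^sub>v w) \<bullet> (D *\<^sub>v (D *\<^sub>v w)))"
    using w A_vec[OF w] D_vec[OF D_vec[OF w]]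
    by (simp add: M_apply scalar_prod_add_distrib[of _ n])
  then show ?thesis using mult_nonneg_nonneg[OF c cross_term_nonneg[OF w]] by simp
qed

text \<open>If \<open>M w = 0\<close> then \<open>A w = 0\<close> by the previous bound, and \<open>A \<ge> I\<close> forces \<open>w = 0\<close>.\<close>

lemma M_trivial_kernel:
  assumes w: "w \<in> carrier_vec n" and 0: "M *\<^sub>v w = 0\<^sub>v n"
  shows "w = 0\<^sub>v n"
proof -
  have "(A *\<^sub>v w) \<bullet> (A *\<^sub>v w) \<le> 0"
    using A_M_lower_bound[OF w] 0 A_vec[OF w] by simp
  then have Aw: "A *\<^sub>v w = 0\<^sub>v n" by (rule scalar_prod_self_eq_0[OF A_vec[OF w]])
  have "w \<bullet> (A *\<^sub>v w) = w \<bullet> w - a * (w \<bullet> (D *\<^sub>v w))"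
    using w D_vec[OF w] by (simp add: A_apply scalar_prod_minus_distrib[of _ n])
  then have "w \<bullet> w \<le> 0"
    using Aw w mult_nonneg_nonpos[OF a neg[OF w]] by simp
  then show ?thesis by (rule scalar_prod_self_eq_0[OF w])
qed

definition "P = matrix_inverse M * A"

lemmas M_inverse = matrix_inverse_of_trivial_kernel[OF M_carrier M_trivial_kernel]

lemma P_carrier: "P \<in> carrier_mat n n"
  using M_inverse(1) A_carrier by (simp add: P_def)

text \<open>Passing to \<open>w = M\<inverse> v\<close> removes the inverse from all later computations.\<close>

lemma P_resolvent:
  assumes v: "v \<in> carrier_vec n"
  obtains w where "w \<in> carrier_vec n" "v = M *\<^sub>v w" "P *\<^sub>v v = A *\<^sub>v w"
proof
  define w where "w = matrix_inverse M *\<^sub>v v"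
  show w: "w \<in> carrier_vec n" unfolding w_def using M_inverse(1) v by simp
  show Mw: "v = M *\<^sub>v w"
    unfolding w_def using assoc_mult_mat_vec[OF M_carrier M_inverse(1) v] M_inverse(2) v by simp
  have "P *\<^sub>v v = matrix_inverse M *\<^sub>v (M *\<^sub>v (A *\<^sub>v w))"
    unfolding P_def M_A_commute[OF w] Mw[symmetric]
    by (rule assoc_mult_mat_vec[OF M_inverse(1) A_carrier v])
  also have "\<dots> = A *\<^sub>v w"
    using assoc_mult_mat_vec[OF M_inverse(1) M_carrier A_vec[OF w]] M_inverse(3) A_vec[OF w]
    by simp
  finally show "P *\<^sub>v v = A *\<^sub>v w" .
qed

lemma P_firmly_nonexpansive: "firmly_nonexpansive n P"
  unfolding firmly_nonexpansive_def
proof (intro conjI ballI)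
  show "P \<in> carrier_mat n n" by (rule P_carrier)
  fix v :: "real vec" assume "v \<in> carrier_vec n"
  then obtain w where "w \<in> carrier_vec n" "v = M *\<^sub>v w" "P *\<^sub>v v = A *\<^sub>v w"
    by (rule P_resolvent)
  then show "(P *\<^sub>v v) \<bullet> (P *\<^sub>v v) \<le> (P *\<^sub>v v) \<bullet> v" using A_M_lower_bound by simp
qed

lemma P_self_adjoint: "self_adjoint n P"
  unfolding self_adjoint_def
proof (intro conjI ballI)
  show "P \<in> carrier_mat n n" by (rule P_carrier)
  fix x y :: "real vec" assume x: "x \<in> carrier_vec n" and y: "y \<in> carrier_vec n"
  obtain w where w: "w \<in> carrier_vec n" and xw: "x = M *\<^sub>v w" "P *\<^sub>v x = A *\<^sub>v w"
    by (rule P_resolvent[OF x])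
  obtain z where z: "z \<in> carrier_vec n" and yz: "y = M *\<^sub>v z" "P *\<^sub>v y = A *\<^sub>v z"
    by (rule P_resolvent[OF y])
  have DDw: "D *\<^sub>v (D *\<^sub>v w) \<in> carrier_vec n" and DDz: "D *\<^sub>v (D *\<^sub>v z) \<in> carrier_vec n"
    using w z by (auto intro: D_vec)
  \<comment> \<open>Moving \<open>A\<close> and then both factors \<open>D\<close> across the inner product.\<close>
  have "(A *\<^sub>v w) \<bullet> (D *\<^sub>v (D *\<^sub>v z)) = w \<bullet> (D *\<^sub>v (D *\<^sub>v (A *\<^sub>v z)))"
    using self_adjointD[OF A_self_adjoint w DDz] D_A_commute z D_vec by simp
  also have "\<dots> = (D *\<^sub>v (D *\<^sub>v w)) \<bullet> (A *\<^sub>v z)"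
    using self_adjointD[OF sa] w z D_vec A_vec by simp
  finally have "(A *\<^sub>v w) \<bullet> (M *\<^sub>v z) = (M *\<^sub>v w) \<bullet> (A *\<^sub>v z)"
    using A_vec[OF w] A_vec[OF z] w z DDw DDz
    by (simp add: M_apply add_scalar_prod_distrib[of _ n] scalar_prod_add_distrib[of _ n])
  then show "(P *\<^sub>v x) \<bullet> y = x \<bullet> (P *\<^sub>v y)" using xw yz by simp
qed

end

section \<open>The discrete Dirichlet Laplacian\<close>

definition tridiag_entry :: "nat \<Rightarrow> nat \<Rightarrow> real" where
  "tridiag_entry i j = (if i = j then -2 else if i = Suc j \<or> j = Suc i then 1 else 0)"

lemma tridiag_entry_sym: "tridiag_entry i j = tridiag_entry j i"
  by (auto simp: tridiag_entry_def)

lemma tridiag_row_sum_nonpos: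
  assumes i: "i < m"
  shows "(\<Sum>j<m. tridiag_entry i j) \<le> 0"
proof -
  have "tridiag_entry i j = (if j = i then -2 else 0) + (if j = Suc i then 1 else 0)
      + (if i = Suc j then 1 else 0)" for j
    by (auto simp: tridiag_entry_def)
  moreover have "(\<Sum>j<m. if i = Suc j then 1 else 0 :: real) \<le> 1"
    by (cases i) auto
  ultimately show ?thesis using i by (simp add: sum.distrib)
qed

text \<open>Off the diagonal the entries are nonnegative, so \<open>2 x\<^sub>i x\<^sub>j \<le> x\<^sub>i\<^sup>2 + x\<^sub>j\<^sup>2\<close> bounds the quadratic
  form by \<open>\<Sum>\<^sub>i r\<^sub>i x\<^sub>i\<^sup>2\<close> with the row sums \<open>r\<^sub>i \<le> 0\<close>: diagonal dominance.\<close>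

lemma tridiag_quadratic_form_nonpos:
  fixes x :: "nat \<Rightarrow> real"
  shows "(\<Sum>i<m. \<Sum>j<m. tridiag_entry i j * (x i * x j)) \<le> 0"
proof -
  let ?t = tridiag_entry
  have "?t i j * (x i * x j) \<le> ?t i j * (x i)\<^sup>2 / 2 + ?t i j * (x j)\<^sup>2 / 2" for i j
    using sum_squares_bound[of "x i" "x j"]
    by (auto simp: tridiag_entry_def power2_eq_square)
  then have "(\<Sum>i<m. \<Sum>j<m. ?t i j * (x i * x j))
      \<le> (\<Sum>i<m. \<Sum>j<m. ?t i j * (x i)\<^sup>2 / 2 + ?t i j * (x j)\<^sup>2 / 2)"
    by (intro sum_mono)
  also have "\<dots> = (\<Sum>i<m. \<Sum>j<m. ?t i j * (x i)\<^sup>2 / 2)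
      + (\<Sum>i<m. \<Sum>j<m. ?t i j * (x j)\<^sup>2 / 2)"
    by (simp only: sum.distrib)
  also have "(\<Sum>i<m. \<Sum>j<m. ?t i j * (x j)\<^sup>2 / 2) = (\<Sum>i<m. \<Sum>j<m. ?t i j * (x i)\<^sup>2 / 2)"
    by (subst sum.swap) (simp add: tridiag_entry_sym)
  also have "(\<Sum>i<m. \<Sum>j<m. ?t i j * (x i)\<^sup>2 / 2) + (\<Sum>i<m. \<Sum>j<m. ?t i j * (x i)\<^sup>2 / 2)
      = (\<Sum>i<m. (\<Sum>j<m. ?t i j) * (x i)\<^sup>2)"
    by (simp flip: sum.distrib add: sum_distrib_right)
  also have "\<dots> \<le> 0"
    by (intro sum_nonpos mult_nonpos_nonneg tridiag_row_sum_nonpos) auto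
  finally show ?thesis .
qed

lemma dirichlet_laplacian_eq:
  "dirichlet_laplacian m h = (1 / h\<^sup>2) \<cdot>\<^sub>m mat m m (\<lambda>(i, j). tridiag_entry i j)"
  by (simp add: dirichlet_laplacian_def tridiag_entry_def)

lemma dirichlet_laplacian_bilinear:
  assumes "x \<in> carrier_vec m" "y \<in> carrier_vec m"
  shows "x \<bullet> (dirichlet_laplacian m h *\<^sub>v y)
    = (1 / h\<^sup>2) * (\<Sum>i<m. \<Sum>j<m. tridiag_entry i j * (x $ i * y $ j))"
  using assms
  by (simp add: dirichlet_laplacian_eq smult_mat_mult_vec[of _ m m] scalar_prod_def
      sum_distrib_left atLeast0LessThan mult_ac)

lemma dirichlet_laplacian_self_adjoint: "self_adjoint m (dirichlet_laplacian m h)"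
  unfolding self_adjoint_def
proof (intro conjI ballI)
  show C: "dirichlet_laplacian m h \<in> carrier_mat m m" by (simp add: dirichlet_laplacian_eq)
  fix x y :: "real vec" assume x: "x \<in> carrier_vec m" and y: "y \<in> carrier_vec m"
  have "(dirichlet_laplacian m h *\<^sub>v x) \<bullet> y = y \<bullet> (dirichlet_laplacian m h *\<^sub>v x)"
    using C x y by (intro comm_scalar_prod[of _ m]) auto
  also have "\<dots> = x \<bullet> (dirichlet_laplacian m h *\<^sub>v y)"
    unfolding dirichlet_laplacian_bilinear[OF y x] dirichlet_laplacian_bilinear[OF x y]
    by (subst sum.swap) (simp add: tridiag_entry_sym mult_ac)
  finally show "(dirichlet_laplacian m h *\<^sub>v x) \<bullet> y = x \<bullet> (dirichlet_laplacian m h *\<^sub>v y)" .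
qed

lemma dirichlet_laplacian_nonpos:
  assumes "v \<in> carrier_vec m"
  shows "v \<bullet> (dirichlet_laplacian m h *\<^sub>v v) \<le> 0"
  unfolding dirichlet_laplacian_bilinear[OF assms assms]
  by (intro mult_nonneg_nonpos tridiag_quadratic_form_nonpos) simp

lemma step_mat_props:
  assumes "0 \<le> \<tau>"
  shows "self_adjoint m (step_mat m h \<epsilon> i \<tau>)"
    and "firmly_nonexpansive m (step_mat m h \<epsilon> i \<tau>)"
proof -
  interpret implicit_step m "dirichlet_laplacian m h" "real i * \<tau>" "\<epsilon>\<^sup>2 * \<tau>"
    using assms by unfold_locales
      (auto intro: dirichlet_laplacian_self_adjoint dirichlet_laplacian_nonpos)
  have "step_mat m h \<epsilon> i \<tau> = P"
    by (simp add: step_mat_def P_def M_def A_def Let_def)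
  then show "self_adjoint m (step_mat m h \<epsilon> i \<tau>)" "firmly_nonexpansive m (step_mat m h \<epsilon> i \<tau>)"
    using P_self_adjoint P_firmly_nonexpansive by auto
qed

section \<open>Stability of the parareal iteration\<close>

lemma parareal_carrier:
  assumes "\<And>v. v \<in> carrier_vec m \<Longrightarrow> F v \<in> carrier_vec m"
    and "\<And>v. v \<in> carrier_vec m \<Longrightarrow> G v \<in> carrier_vec m"
    and "u \<in> carrier_vec m"
  shows "parareal F G u k n \<in> carrier_vec m"
  using assms by (induction F G u k n rule: parareal.induct) auto

lemma parareal_norm_le_sum:
  assumes F: "\<And>v. v \<in> carrier_vec m \<Longrightarrow> F v \<in> carrier_vec m"
    and G: "\<And>v. v \<in> carrier_vec m \<Longrightarrow> G v \<in> carrier_vec m"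
    and G_le: "\<And>v. v \<in> carrier_vec m \<Longrightarrow> euclid_norm (G v) \<le> euclid_norm v"
    and diff_le: "\<And>v. v \<in> carrier_vec m \<Longrightarrow> euclid_norm (F v - G v) \<le> euclid_norm v"
    and u: "u \<in> carrier_vec m"
  shows "euclid_norm (parareal F G u (Suc k) n)
    \<le> euclid_norm u + (\<Sum>j<n. euclid_norm (parareal F G u k j))"
proof (induction n)
  case 0
  show ?case by simp
next
  case (Suc n)
  let ?U = "parareal F G u"
  have U: "?U i j \<in> carrier_vec m" for i j by (rule parareal_carrier[OF F G u])
  have "?U (Suc k) (Suc n) = G (?U (Suc k) n) + (F (?U k n) - G (?U k n))"
    using F[OF U[of k n]] G[OF U[of k n]] G[OF U[of "Suc k" n]] by (intro eq_vecI) auto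
  also have "euclid_norm \<dots> \<le> euclid_norm (G (?U (Suc k) n)) + euclid_norm (F (?U k n) - G (?U k n))"
    using F[OF U] G[OF U] by (intro euclid_norm_triangle[of _ m]) auto
  also have "\<dots> \<le> euclid_norm (?U (Suc k) n) + euclid_norm (?U k n)"
    by (intro add_mono G_le diff_le U)
  finally show ?case using Suc by simp
qed

theorem theorem3p8:
  fixes h \<epsilon> T :: real and N\<^sub>x N J :: nat and u\<^sub>0 :: "real vec"
  assumes "h > 0" and "N\<^sub>x \<ge> 3" and "\<epsilon> > 0" and "T > 0" and "N \<ge> 1" and "J \<ge> 2"
    and "u\<^sub>0 \<in> carrier_vec (N\<^sub>x - 2)"
  defines "U \<equiv> PA_II (N\<^sub>x - 2) h \<epsilon> J (T / real N) u\<^sub>0"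
  shows "\<forall>n\<in>{0..N - 1}. \<forall>k.
    euclid_norm (U (Suc k) (Suc n))
      \<le> euclid_norm u\<^sub>0 + real (n + 1) * Max ((\<lambda>j. euclid_norm (U k j)) ` {0..n})"
proof (intro ballI allI)
  fix n k :: nat
  define m where "m = N\<^sub>x - 2"
  define G where "G = coarse_mat m h \<epsilon> 2 (T / real N)"
  define F where "F = fine_mat m h \<epsilon> J 2 (T / real N)"
  have G: "firmly_nonexpansive m G"
    unfolding G_def coarse_mat_def using assms by (intro step_mat_props) auto
  have F: "firmly_nonexpansive m F"
    unfolding F_def fine_mat_def using assms
    by (intro firmly_nonexpansive_pow step_mat_props) auto
  have GC: "G \<in> carrier_mat m m" and FC: "F \<in> carrier_mat m m"
    using F G by (auto simp: firmly_nonexpansive_def)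
  have U: "U = parareal (\<lambda>v. F *\<^sub>v v) (\<lambda>v. G *\<^sub>v v) u\<^sub>0"
    by (simp add: U_def PA_II_def F_def G_def m_def)
  have "euclid_norm (U (Suc k) (Suc n)) \<le> euclid_norm u\<^sub>0 + (\<Sum>j<Suc n. euclid_norm (U k j))"
    unfolding U
  proof (rule parareal_norm_le_sum)
    show "u\<^sub>0 \<in> carrier_vec m" using assms by (simp add: m_def)
    fix v :: "real vec" assume v: "v \<in> carrier_vec m"
    show "F *\<^sub>v v \<in> carrier_vec m" "G *\<^sub>v v \<in> carrier_vec m" using FC GC v by auto
    show "euclid_norm (G *\<^sub>v v) \<le> euclid_norm v"
      using firmly_nonexpansive_contraction[OF G v] by (simp add: euclid_norm_sqrt)
    show "euclid_norm (F *\<^sub>v v - G *\<^sub>v v) \<le> euclid_norm v"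
      using firmly_nonexpansive_diff[OF F G v] by (simp add: euclid_norm_sqrt)
  qed
  also have "(\<Sum>j<Suc n. euclid_norm (U k j))
      \<le> real (card {..<Suc n}) * Max ((\<lambda>j. euclid_norm (U k j)) ` {0..n})"
    by (intro sum_bounded_above Max_ge) auto
  finally show "euclid_norm (U (Suc k) (Suc n))
      \<le> euclid_norm u\<^sub>0 + real (n + 1) * Max ((\<lambda>j. euclid_norm (U k j)) ` {0..n})"
    by simp
qed

end
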